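(* There exist computable $(1,2)$-equivalence structures $\mathcal{A}$ and $\mathcal{C}$, both having generic character $\{1\}$, which are not generically computably isomorphic.
   Context: Structures have universe $\omega$. An equivalence structure is computable if its equivalence relation is computable. A $(1,2)$-structure is an equivalence structure consisting of infinitely many classes of size 1 and infinitely many classes of size 2 (and no other classes). $\mathcal{A}(k)$ denotes the set of elements of $\mathcal{A}$ whose equivalence class has size $k$. A set $S\subseteq\omega$ has asymptotic density $\delta$ if $\lim_{n\to\infty} |S\cap\{0,\dots,n\}|/(n+1)=\delta$. $\mathcal{A}$ has generic character $\{k\}$ if $\mathcal{A}(k)$ has asymptotic density one. Two structures $\mathcal{A}$ and $\mathcal{B}$ are generically computably isomorphic if there are an isomorphism $f:\mathcal{A}\to\mathcal{B}$ and a partial computable function $\theta$ such that both the domain and the range of $\theta$ have asymptotic density one, and $\theta(x)=f(x)$ whenever $\theta(x)$ is defined. *)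

theory Defs
  imports Complex_Main
begin

section \<open>Partial computable functions\<close>

text \<open>Programs for the partial recursive functions. \<open>eval p xs y\<close> means that \<open>p\<close>, run on the
  arguments \<open>xs\<close>, halts with value \<open>y\<close>. Arities are not recorded in programs: \<open>Zero\<close> accepts any
  number of arguments, and \<open>Proj i\<close> any number greater than \<open>i\<close>, so one program may compute a
  function of each arity. The recursion variable of \<open>Prec\<close> and the search variable of \<open>Mu\<close> are the
  first argument.\<close>

datatype recf =
    Zero
  | Succ
  | Proj nat
  | Comp recf "recf list"
  | Prec recf recf
  | Mu recf

inductive eval :: "recf \<Rightarrow> nat list \<Rightarrow> nat \<Rightarrow> bool" where
  zero: "eval Zero xs 0"
| succ: "eval Succ [x] (Suc x)"
| proj: "i < length xs \<Longrightarrow> eval (Proj i) xs (xs ! i)"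
| comp: "list_all2 (\<lambda>g y. eval g xs y) gs ys \<Longrightarrow> eval f ys z \<Longrightarrow> eval (Comp f gs) xs z"
| prec_0: "eval f xs y \<Longrightarrow> eval (Prec f g) (0 # xs) y"
| prec_Suc: "eval (Prec f g) (n # xs) r \<Longrightarrow> eval g (n # r # xs) y
    \<Longrightarrow> eval (Prec f g) (Suc n # xs) y"
| mu: "eval f (n # xs) 0 \<Longrightarrow> (\<forall>m<n. \<exists>y. eval f (m # xs) (Suc y)) \<Longrightarrow> eval (Mu f) xs n"

lemma eval_deterministic:
  assumes "eval p xs y" and "eval p xs z"
  shows "y = z"
  using assms
proof (induction arbitrary: z rule: eval.induct)
  case (zero xs)
  then show ?case by cases auto
next
  case (succ x)
  then show ?case by cases auto
next
  case (proj i xs)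
  from proj(2) show ?case by cases auto
next
  case (comp xs gs ys f w)
  from comp.prems obtain ys' where
    ys': "list_all2 (\<lambda>g y. eval g xs y) gs ys'" and f: "eval f ys' z"
    by cases auto
  have "ys = ys'"
    using comp.IH(1) ys' unfolding list_all2_conv_all_nth by (metis nth_equalityI)
  with comp.IH(2) f show ?case by blast
next
  case (prec_0 f xs y g)
  from prec_0.prems prec_0.IH show ?case by cases auto
next
  case (prec_Suc f g n xs r y)
  from prec_Suc.prems obtain r' where "eval (Prec f g) (n # xs) r'" "eval g (n # r' # xs) z"
    by cases auto
  with prec_Suc.IH show ?case by blast
next
  case (mu f n xs)
  from mu.prems have z: "eval f (z # xs) 0" "\<forall>m<z. \<exists>y. eval f (m # xs) (Suc y)"
    by (cases, simp)+
  have "\<not> z < n" using mu.IH(2) z(1) by fastforce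
  moreover have "\<not> n < z" using mu.IH(1) z(2) by fastforce
  ultimately show ?case by simp
qed

definition partial_computable :: "(nat \<rightharpoonup> nat) \<Rightarrow> bool" where
  "partial_computable \<theta> \<longleftrightarrow> (\<exists>p. \<forall>x y. \<theta> x = Some y \<longleftrightarrow> eval p [x] y)"

definition computable_rel :: "nat rel \<Rightarrow> bool" where
  "computable_rel R \<longleftrightarrow> (\<exists>p. \<forall>x y. eval p [x, y] (if (x, y) \<in> R then 1 else 0))"


section \<open>Asymptotic density\<close>

definition has_density :: "nat set \<Rightarrow> real \<Rightarrow> bool" where
  "has_density S \<delta> \<longleftrightarrow> (\<lambda>n. real (card (S \<inter> {0..n})) / real (n + 1)) \<longlonglongrightarrow> \<delta>"


section \<open>Equivalence structures\<close>

text \<open>An equivalence structure with universe \<open>\<omega>\<close> is given by its equivalence relation, a relation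
  \<open>E\<close> with \<open>equiv UNIV E\<close>.\<close>

definition computable_equiv_structure :: "nat rel \<Rightarrow> bool" where
  "computable_equiv_structure E \<longleftrightarrow> equiv UNIV E \<and> computable_rel E"

definition one_two_structure :: "nat rel \<Rightarrow> bool" where
  "one_two_structure E \<longleftrightarrow>
     equiv UNIV E \<and>
     infinite {c \<in> UNIV // E. card c = 1} \<and>
     infinite {c \<in> UNIV // E. card c = 2} \<and>
     (\<forall>c \<in> UNIV // E. card c = 1 \<or> card c = 2)"

definition elements_of_size :: "nat rel \<Rightarrow> nat \<Rightarrow> nat set" where
  "elements_of_size E k = {x. finite (E `` {x}) \<and> card (E `` {x}) = k}"

text \<open>\<open>generic_character E k\<close> says that \<open>E\<close> has generic character the singleton \<open>{k}\<close>.\<close>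

definition generic_character :: "nat rel \<Rightarrow> nat \<Rightarrow> bool" where
  "generic_character E k \<longleftrightarrow> has_density (elements_of_size E k) 1"

definition isomorphism :: "nat rel \<Rightarrow> nat rel \<Rightarrow> (nat \<Rightarrow> nat) \<Rightarrow> bool" where
  "isomorphism A B f \<longleftrightarrow> bij f \<and> (\<forall>x y. (x, y) \<in> A \<longleftrightarrow> (f x, f y) \<in> B)"

definition generically_computably_isomorphic :: "nat rel \<Rightarrow> nat rel \<Rightarrow> bool" where
  "generically_computably_isomorphic A B \<longleftrightarrow>
     (\<exists>f \<theta>. isomorphism A B f \<and> partial_computable \<theta> \<and>
        has_density (dom \<theta>) 1 \<and> has_density (ran \<theta>) 1 \<and>
        (\<forall>x \<in> dom \<theta>. \<theta> x = Some (f x)))"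

end

theory Submission
  imports Defs "HOL-Library.Nat_Bijection" "HOL-Real_Asymp.Real_Asymp"
begin

text \<open>
  Write \<open>A(k)\<close> for the set of elements of \<open>A\<close> whose class has size \<open>k\<close>. Let \<open>A(2)\<close> be the set
  of powers of two, so that \<open>A(1)\<close> is decidable. Suppose that \<open>f\<close> is an isomorphism from \<open>A\<close> to
  \<open>C\<close> which extends a partial computable \<open>\<theta>\<close> with range of density one. The image \<open>\<theta>(A(1))\<close> is
  computably enumerable, it is contained in \<open>C(1)\<close>, and it equals \<open>ran \<theta> \<inter> C(1)\<close>, which has
  density one as soon as \<open>C(1)\<close> has. So it is enough to construct \<open>C\<close> such that \<open>C(1)\<close> has
  density one but no computably enumerable subset of density one. As \<open>C(2)\<close> is itself
  enumerable, this calls for a sparse analogue of Post's simple sets.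

  The numbers are divided into disjoint columns, column \<open>e\<close> being an arithmetic progression of
  difference \<open>2 ^ (e + 1)\<close> that starts above \<open>2 ^ e\<close>. A set of density one meets every
  progression (\<open>has_density_1_meets_progression\<close>). As soon as program \<open>e\<close> is seen to map an
  element of \<open>A(1)\<close> into column \<open>e\<close>, its value is put into \<open>C(2)\<close> together with the partner
  \<open>2 ^ s\<close>, where \<open>s\<close> is the current stage; after that nothing more is done for \<open>e\<close>. The program
  then fails to be part of an isomorphism, since it sends an element of \<open>A(1)\<close> into \<open>C(2)\<close>. Up
  to \<open>n\<close>, only logarithmically many numbers enter \<open>C(2)\<close> (\<open>has_density_1_sparse_complement\<close>).
  Since the partner records the stage, \<open>C\<close> is computable.

  What has to be computed is a simultaneous search through all programs. For this an evaluation
  is represented by a certificate, the list of the assertions in its derivation. Whether a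
  number codes a certificate is a statement with bounded quantifiers (\<open>decidable4_certifies\<close>),
  and a program halts with a given value just if there is a certificate for it
  (\<open>eval_iff_certifies\<close>).\<close>


section \<open>Total computable functions and decidable relations\<close>

text \<open>
  A function is presented by its action on environments, the lists of values of \<open>k\<close> variables,
  so that the closure rules below decide a formula by recursion on its shape. A bound variable
  is pushed to the front of the environment; inside the scope of binders the variables therefore
  appear as \<open>hd xs\<close>, \<open>hd (tl xs)\<close>, \<open>hd (tl (tl xs))\<close> and so on.\<close>

definition total_computable :: "nat \<Rightarrow> (nat list \<Rightarrow> nat) \<Rightarrow> bool" where
  "total_computable k f \<longleftrightarrow> (\<exists>p. \<forall>xs. length xs = k \<longrightarrow> eval p xs (f xs))"

definition decidable :: "nat \<Rightarrow> (nat list \<Rightarrow> bool) \<Rightarrow> bool" where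
  "decidable k P \<longleftrightarrow> total_computable k (\<lambda>xs. if P xs then 1 else 0)"

lemma total_computableI: "(\<And>xs. length xs = k \<Longrightarrow> eval p xs (f xs)) \<Longrightarrow> total_computable k f"
  unfolding total_computable_def by blast

lemma total_computable_cong:
  "total_computable k f \<Longrightarrow> (\<And>xs. length xs = k \<Longrightarrow> f xs = g xs) \<Longrightarrow> total_computable k g"
  unfolding total_computable_def by metis

lemma decidable_cong:
  "decidable k P \<Longrightarrow> (\<And>xs. length xs = k \<Longrightarrow> P xs \<longleftrightarrow> Q xs) \<Longrightarrow> decidable k Q"
  unfolding decidable_def by (erule total_computable_cong) simp

lemma total_computable_comp:
  assumes h: "total_computable (length fs) h" and fs: "\<forall>f \<in> set fs. total_computable k f"
  shows "total_computable k (\<lambda>xs. h (map (\<lambda>f. f xs) fs))"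
proof -
  obtain q where q: "\<And>xs. length xs = length fs \<Longrightarrow> eval q xs (h xs)"
    using h unfolding total_computable_def by blast
  obtain P where P: "\<And>f xs. f \<in> set fs \<Longrightarrow> length xs = k \<Longrightarrow> eval (P f) xs (f xs)"
    using fs unfolding total_computable_def by metis
  have "eval (Comp q (map P fs)) xs (h (map (\<lambda>f. f xs) fs))" if "length xs = k" for xs
    using that by (intro eval.comp[where ys = "map (\<lambda>f. f xs) fs"] q)
      (auto simp: list_all2_conv_all_nth P)
  then show ?thesis by (rule total_computableI)
qed

lemma total_computable_proj: "i < k \<Longrightarrow> total_computable k (\<lambda>xs. xs ! i)"
  by (rule total_computableI) (auto intro: eval.proj)

lemma total_computable_hd_drop: "i < k \<Longrightarrow> total_computable k (\<lambda>xs. hd (drop i xs))"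
  by (rule total_computable_cong[OF total_computable_proj]) (simp_all add: hd_drop_conv_nth)

text \<open>
  The variables of an environment, in the form that the rules for binders produce. Checking one
  step of an evaluation needs four parameters under four nested quantifiers, hence eight
  variables.\<close>

lemma total_computable_var:
  "total_computable (Suc k) (\<lambda>xs. hd xs)"
  "total_computable (Suc (Suc k))
    (\<lambda>xs. hd (tl xs))"
  "total_computable (Suc (Suc (Suc k)))
    (\<lambda>xs. hd (tl (tl xs)))"
  "total_computable (Suc (Suc (Suc (Suc k))))
    (\<lambda>xs. hd (tl (tl (tl xs))))"
  "total_computable (Suc (Suc (Suc (Suc (Suc k)))))
    (\<lambda>xs. hd (tl (tl (tl (tl xs)))))"
  "total_computable (Suc (Suc (Suc (Suc (Suc (Suc k))))))
    (\<lambda>xs. hd (tl (tl (tl (tl (tl xs))))))"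
  "total_computable (Suc (Suc (Suc (Suc (Suc (Suc (Suc k)))))))
    (\<lambda>xs. hd (tl (tl (tl (tl (tl (tl xs)))))))"
  "total_computable (Suc (Suc (Suc (Suc (Suc (Suc (Suc (Suc k))))))))
    (\<lambda>xs. hd (tl (tl (tl (tl (tl (tl (tl xs))))))))"
  using total_computable_hd_drop[of 0] total_computable_hd_drop[of 1]
    total_computable_hd_drop[of 2] total_computable_hd_drop[of 3]
    total_computable_hd_drop[of 4] total_computable_hd_drop[of 5]
    total_computable_hd_drop[of 6] total_computable_hd_drop[of 7]
  by (simp_all add: drop_Suc numeral_eq_Suc)

abbreviation "computable1 f \<equiv> total_computable (Suc 0) (\<lambda>xs. f (hd xs))"
abbreviation "computable2 f \<equiv> total_computable (Suc (Suc 0)) (\<lambda>xs. f (hd xs) (hd (tl xs)))"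
abbreviation "decidable1 P \<equiv> decidable (Suc 0) (\<lambda>xs. P (hd xs))"
abbreviation "decidable2 P \<equiv> decidable (Suc (Suc 0)) (\<lambda>xs. P (hd xs) (hd (tl xs)))"
abbreviation "decidable4 P \<equiv> decidable (Suc (Suc (Suc (Suc 0))))
  (\<lambda>xs. P (hd xs) (hd (tl xs)) (hd (tl (tl xs))) (hd (tl (tl (tl xs)))))"

lemma computable_subst1:
  "computable1 h \<Longrightarrow> total_computable k f \<Longrightarrow> total_computable k (\<lambda>xs. h (f xs))"
  using total_computable_comp[of "[f]" "\<lambda>xs. h (hd xs)" k] by simp

lemma computable_subst2:
  "computable2 h \<Longrightarrow> total_computable k f \<Longrightarrow> total_computable k g
    \<Longrightarrow> total_computable k (\<lambda>xs. h (f xs) (g xs))"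
  using total_computable_comp[of "[f, g]" "\<lambda>xs. h (hd xs) (hd (tl xs))" k] by simp

lemma decidable_subst1:
  "decidable1 P \<Longrightarrow> total_computable k f \<Longrightarrow> decidable k (\<lambda>xs. P (f xs))"
  unfolding decidable_def by (rule computable_subst1)

lemma decidable_subst2:
  "decidable2 P \<Longrightarrow> total_computable k f \<Longrightarrow> total_computable k g
    \<Longrightarrow> decidable k (\<lambda>xs. P (f xs) (g xs))"
  unfolding decidable_def by (rule computable_subst2)

lemma decidable_subst4:
  "decidable4 P \<Longrightarrow> total_computable k f \<Longrightarrow> total_computable k g \<Longrightarrow> total_computable k f'
    \<Longrightarrow> total_computable k g' \<Longrightarrow> decidable k (\<lambda>xs. P (f xs) (g xs) (f' xs) (g' xs))"
  unfolding decidable_def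
  using total_computable_comp[of "[f, g, f', g']"
      "\<lambda>xs. if P (hd xs) (hd (tl xs)) (hd (tl (tl xs))) (hd (tl (tl (tl xs)))) then 1 else 0" k]
  by simp

lemma computable1_Suc: "computable1 Suc"
  by (rule total_computableI[of _ Succ]) (auto simp: length_Suc_conv intro: eval.succ)

lemmas computable_Suc = computable_subst1[OF computable1_Suc]

lemma computable_const: "total_computable k (\<lambda>_. c)"
proof (induction c)
  case 0 show ?case by (rule total_computableI[of _ Zero]) (rule eval.zero)
next
  case (Suc c) then show ?case by (rule computable_Suc)
qed

text \<open>
  The recursion runs in the environment extended by the recursion variable and the previous
  value, which is the argument order of \<open>Prec\<close>.\<close>

lemma computable_rec:
  assumes a: "total_computable k a"
    and g: "total_computable (Suc (Suc k)) (\<lambda>zs. g (hd zs) (hd (tl zs)) (tl (tl zs)))"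
    and m: "total_computable k m"
  shows "total_computable k (\<lambda>xs. rec_nat (a xs) (\<lambda>n r. g n r xs) (m xs))"
proof -
  obtain pa where pa: "\<And>xs. length xs = k \<Longrightarrow> eval pa xs (a xs)"
    using a unfolding total_computable_def by blast
  obtain pg where pg: "\<And>zs. length zs = Suc (Suc k) \<Longrightarrow>
      eval pg zs (g (hd zs) (hd (tl zs)) (tl (tl zs)))"
    using g unfolding total_computable_def by blast
  have rec: "eval (Prec pa pg) (n # xs) (rec_nat (a xs) (\<lambda>n r. g n r xs) n)"
    if "length xs = k" for n xs
  proof (induction n)
    case 0 show ?case using pa[OF that] by (auto intro: eval.prec_0)
  next
    case (Suc n)
    show ?case using eval.prec_Suc[OF Suc pg] that by simp
  qed
  have "total_computable (Suc k) (\<lambda>zs. rec_nat (a (tl zs)) (\<lambda>n r. g n r (tl zs)) (hd zs))"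
    by (rule total_computableI[of _ "Prec pa pg"]) (auto simp: length_Suc_conv intro: rec)
  then have "total_computable (length (m # map (\<lambda>i xs. xs ! i) [0..<k]))
      (\<lambda>zs. rec_nat (a (tl zs)) (\<lambda>n r. g n r (tl zs)) (hd zs))" by simp
  from total_computable_comp[OF this, of k] have
    "total_computable k (\<lambda>xs. rec_nat (a (map (\<lambda>i. xs ! i) [0..<k]))
      (\<lambda>n r. g n r (map (\<lambda>i. xs ! i) [0..<k])) (m xs))"
    using m total_computable_proj by (auto simp: comp_def)
  then show ?thesis by (rule total_computable_cong) (auto simp: map_nth)
qed

lemma computable2_plus: "computable2 (+)"
proof -
  have "total_computable (Suc (Suc 0)) (\<lambda>xs. rec_nat (hd xs) (\<lambda>n r. Suc r) (hd (tl xs)))"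
    by (intro computable_rec computable_Suc total_computable_var)
  moreover have "rec_nat x (\<lambda>n r. Suc r) y = x + y" for x y :: nat by (induction y) auto
  ultimately show ?thesis by simp
qed

lemmas computable_plus = computable_subst2[OF computable2_plus]

lemma computable2_times: "computable2 (*)"
proof -
  have "total_computable (Suc (Suc 0)) (\<lambda>xs. rec_nat 0 (\<lambda>n r. r + hd xs) (hd (tl xs)))"
    by (intro computable_rec computable_plus computable_const total_computable_var)
  moreover have "rec_nat 0 (\<lambda>n r. r + x) y = x * y" for x y :: nat by (induction y) auto
  ultimately show ?thesis by simp
qed

lemmas computable_times = computable_subst2[OF computable2_times]

lemma computable1_pred: "computable1 (\<lambda>x. x - 1)"
proof -
  have "total_computable (Suc 0) (\<lambda>xs. rec_nat 0 (\<lambda>n r. n) (hd xs))"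
    by (intro computable_rec computable_const total_computable_var)
  moreover have "rec_nat 0 (\<lambda>n r. n) y = y - 1" for y :: nat by (cases y) auto
  ultimately show ?thesis by simp
qed

lemma computable2_minus: "computable2 (-)"
proof -
  have "total_computable (Suc (Suc 0)) (\<lambda>xs. rec_nat (hd xs) (\<lambda>n r. r - 1) (hd (tl xs)))"
    by (intro computable_rec computable_subst1[OF computable1_pred] total_computable_var)
  moreover have "rec_nat x (\<lambda>n r. r - 1) y = x - y" for x y :: nat by (induction y) auto
  ultimately show ?thesis by simp
qed

lemmas computable_minus = computable_subst2[OF computable2_minus]

lemma computable1_pow2: "computable1 (\<lambda>x. 2 ^ x)"
proof -
  have "total_computable (Suc 0) (\<lambda>xs. rec_nat 1 (\<lambda>n r. 2 * r) (hd xs))"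
    by (intro computable_rec computable_times computable_const total_computable_var)
  moreover have "rec_nat 1 (\<lambda>n r. 2 * r) y = (2 ^ y :: nat)" for y by (induction y) auto
  ultimately show ?thesis by (simp del: One_nat_def)
qed

lemmas computable_pow2 = computable_subst1[OF computable1_pow2]

lemma decidable_le:
  assumes "total_computable k f" "total_computable k g"
  shows "decidable k (\<lambda>xs. f xs \<le> g xs)"
  unfolding decidable_def
  by (rule total_computable_cong[of k "\<lambda>xs. 1 - (f xs - g xs)"])
     (intro computable_minus computable_const assms, auto)

lemma decidable_not: "decidable k P \<Longrightarrow> decidable k (\<lambda>xs. \<not> P xs)"
  unfolding decidable_def
  by (rule total_computable_cong[of k "\<lambda>xs. 1 - (if P xs then 1 else 0)"])
     (intro computable_minus computable_const, auto)

lemma decidable_conj: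
  "decidable k P \<Longrightarrow> decidable k Q \<Longrightarrow> decidable k (\<lambda>xs. P xs \<and> Q xs)"
  unfolding decidable_def
  by (rule total_computable_cong[of k "\<lambda>xs. (if P xs then 1 else 0) * (if Q xs then 1 else 0)"])
     (intro computable_times, auto)

lemma decidable_disj:
  assumes "decidable k P" "decidable k Q"
  shows "decidable k (\<lambda>xs. P xs \<or> Q xs)"
  using decidable_not[OF decidable_conj[OF assms[THEN decidable_not]]] by simp

lemma decidable_imp:
  assumes "decidable k P" "decidable k Q"
  shows "decidable k (\<lambda>xs. P xs \<longrightarrow> Q xs)"
  unfolding imp_conv_disj by (intro decidable_disj decidable_not assms)

lemma decidable_iff:
  assumes "decidable k P" "decidable k Q"
  shows "decidable k (\<lambda>xs. P xs \<longleftrightarrow> Q xs)"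
  using decidable_conj[OF decidable_imp[OF assms] decidable_imp[OF assms(2,1)]]
  by (rule decidable_cong) blast

lemma decidable_eq:
  assumes "total_computable k f" "total_computable k g"
  shows "decidable k (\<lambda>xs. f xs = g xs)"
  using decidable_conj[OF decidable_le[OF assms] decidable_le[OF assms(2,1)]]
  by (rule decidable_cong) auto

text \<open>
  Bounded search is a primitive recursion whose accumulator records whether a witness has been
  met. The recursion supplies the accumulator as a second variable, which the program for the
  matrix must skip.\<close>

lemma decidable_ex:
  assumes "total_computable k b" and P: "decidable (Suc k) (\<lambda>zs. P (hd zs) (tl zs))"
  shows "decidable k (\<lambda>xs. \<exists>i < b xs. P i xs)"
proof -
  obtain p where p: "\<And>zs. length zs = Suc k \<Longrightarrow> eval p zs (if P (hd zs) (tl zs) then 1 else 0)"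
    using P unfolding total_computable_def decidable_def by blast
  have "eval (Comp p (Proj 0 # map (\<lambda>i. Proj (Suc (Suc i))) [0..<k])) zs
      (if P (hd zs) (tl (tl zs)) then 1 else 0)" if "length zs = Suc (Suc k)" for zs
  proof (rule eval.comp)
    from that obtain n r xs where [simp]: "zs = n # r # xs" "length xs = k"
      by (auto simp: length_Suc_conv)
    show "list_all2 (\<lambda>g y. eval g zs y) (Proj 0 # map (\<lambda>i. Proj (Suc (Suc i))) [0..<k])
        (hd zs # tl (tl zs))"
      using eval.proj[of 0 "n # r # xs"] eval.proj[of "Suc (Suc _)" "n # r # xs"]
      by (auto simp: list_all2_conv_all_nth nth_Cons split: nat.split)
    show "eval p (hd zs # tl (tl zs)) (if P (hd zs) (tl (tl zs)) then 1 else 0)"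
      using p[of "hd zs # tl (tl zs)"] by simp
  qed
  then have "decidable (Suc (Suc k)) (\<lambda>zs. P (hd zs) (tl (tl zs)))"
    unfolding decidable_def by (rule total_computableI)
  then have "decidable (Suc (Suc k)) (\<lambda>zs. P (hd zs) (tl (tl zs)) \<or> \<not> hd (tl zs) \<le> 0)"
    by (intro decidable_disj decidable_not decidable_le total_computable_var computable_const)
  then have "total_computable k
      (\<lambda>xs. rec_nat 0 (\<lambda>n r. if P n xs \<or> \<not> r \<le> 0 then 1 else 0) (b xs))"
    unfolding decidable_def by (intro computable_rec computable_const assms)
  moreover have "rec_nat 0 (\<lambda>n r. if P n xs \<or> \<not> r \<le> 0 then 1 else 0) m
      = (if \<exists>i < m. P i xs then 1 else 0 :: nat)" for m xs
    by (induction m) (auto simp: less_Suc_eq)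
  ultimately show ?thesis unfolding decidable_def by simp
qed

lemma decidable_all:
  assumes "total_computable k b" and "decidable (Suc k) (\<lambda>zs. P (hd zs) (tl zs))"
  shows "decidable k (\<lambda>xs. \<forall>i < b xs. P i xs)"
  using decidable_not[OF decidable_ex[OF assms(1) decidable_not[OF assms(2)]]] by simp

text \<open>
  This gives the inverse of a computable bijection without an algorithm for it: search for the
  preimage.\<close>

lemma computable_Least:
  assumes P: "decidable (Suc k) (\<lambda>zs. P (hd zs) (tl zs))"
    and ex: "\<And>xs. length xs = k \<Longrightarrow> \<exists>n. P n xs"
  shows "total_computable k (\<lambda>xs. LEAST n. P n xs)"
proof -
  obtain p where p: "\<And>zs. length zs = Suc k \<Longrightarrow> eval p zs (if \<not> P (hd zs) (tl zs) then 1 else 0)"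
    using decidable_not[OF P] unfolding total_computable_def decidable_def by blast
  have "eval (Mu p) xs (LEAST n. P n xs)" if "length xs = k" for xs
  proof (rule eval.mu)
    show "eval p ((LEAST n. P n xs) # xs) 0"
      using p[of "(LEAST n. P n xs) # xs"] LeastI_ex[OF ex[OF that]] that by simp
    show "\<forall>m < (LEAST n. P n xs). \<exists>y. eval p (m # xs) (Suc y)"
    proof (intro allI impI)
      fix m assume "m < (LEAST n. P n xs)"
      then show "\<exists>y. eval p (m # xs) (Suc y)"
        using p[of "m # xs"] not_less_Least[of m "\<lambda>n. P n xs"] that by auto
    qed
  qed
  then show ?thesis by (rule total_computableI)
qed

lemmas computable_intros =
  computable_const total_computable_var computable_Suc computable_plus computable_times
  computable_minus computable_pow2
  decidable_le decidable_eq decidable_not decidable_conj decidable_disj decidable_imp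
  decidable_iff decidable_ex decidable_all


section \<open>Codes of pairs and lists\<close>

lemma computable1_triangle: "computable1 triangle"
proof -
  have "total_computable (Suc 0) (\<lambda>xs. rec_nat 0 (\<lambda>n r. r + Suc n) (hd xs))"
    by (intro computable_rec computable_intros)
  moreover have "rec_nat 0 (\<lambda>n r. r + Suc n) y = triangle y" for y by (induction y) auto
  ultimately show ?thesis by simp
qed

lemma computable2_pair: "computable2 (\<lambda>a b. prod_encode (a, b))"
  unfolding prod_encode_def prod.case
  by (intro computable_subst1[OF computable1_triangle] computable_intros)

lemmas computable_pair = computable_subst2[OF computable2_pair]

lemma computable1_fst: "computable1 (\<lambda>z. fst (prod_decode z))"
proof -
  have eq: "(LEAST a. \<exists>b < Suc z. z = prod_encode (a, b)) = fst (prod_decode z)" for z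
  proof (rule Least_equality)
    show "\<exists>b < Suc z. z = prod_encode (fst (prod_decode z), b)"
      using le_prod_encode_2[of "snd (prod_decode z)" "fst (prod_decode z)"]
      by (intro exI[of _ "snd (prod_decode z)"]) (simp add: less_Suc_eq_le)
  qed auto
  have "total_computable (Suc 0) (\<lambda>xs. LEAST a. \<exists>b < Suc (hd xs). hd xs = prod_encode (a, b))"
  proof (intro computable_Least computable_intros computable_pair)
    fix xs :: "nat list"
    show "\<exists>a. \<exists>b < Suc (hd xs). hd xs = prod_encode (a, b)"
      by (metis le_imp_less_Suc le_prod_encode_2 prod_decode_inverse prod.collapse)
  qed
  then show ?thesis unfolding eq .
qed

lemma computable1_snd: "computable1 (\<lambda>z. snd (prod_decode z))"
proof -
  have eq: "(LEAST b. z = prod_encode (fst (prod_decode z), b)) = snd (prod_decode z)" for z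
    by (rule Least_equality) (simp, metis order_refl prod_encode_inverse snd_conv)
  have "total_computable (Suc 0) (\<lambda>xs. LEAST b. hd xs = prod_encode (fst (prod_decode (hd xs)), b))"
  proof (intro computable_Least computable_intros computable_pair computable_subst1[OF computable1_fst])
    fix xs :: "nat list"
    show "\<exists>b. hd xs = prod_encode (fst (prod_decode (hd xs)), b)"
      by (metis prod_decode_inverse prod.collapse)
  qed
  then show ?thesis unfolding eq .
qed

lemmas computable_fst = computable_subst1[OF computable1_fst]
lemmas computable_snd = computable_subst1[OF computable1_snd]

definition hd_code :: "nat \<Rightarrow> nat" where
  "hd_code c = fst (prod_decode (c - 1))"

text \<open>
  The tail of the code \<open>0\<close> of the empty list is again \<open>0\<close>, because \<open>prod_decode 0 = (0, 0)\<close>; so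
  dropping too many elements is harmless.\<close>

definition drop_code :: "nat \<Rightarrow> nat \<Rightarrow> nat" where
  "drop_code i c = rec_nat c (\<lambda>_ r. snd (prod_decode (r - 1))) i"

definition cons_code :: "nat \<Rightarrow> nat \<Rightarrow> nat" where
  "cons_code x c = Suc (prod_encode (x, c))"

lemma hd_code: "xs \<noteq> [] \<Longrightarrow> hd_code (list_encode xs) = hd xs"
  by (cases xs) (auto simp: hd_code_def)

lemma prod_decode_0: "prod_decode 0 = (0, 0)"
  using prod_encode_inverse[of "(0, 0)"] by (simp add: prod_encode_def)

lemma drop_code: "drop_code i (list_encode xs) = list_encode (drop i xs)"
proof (induction i)
  case (Suc i)
  then show ?case
    by (cases "drop i xs") (auto simp: drop_code_def prod_decode_0 drop_Suc tl_drop[symmetric])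
qed (simp add: drop_code_def)

lemma cons_code: "cons_code x (list_encode xs) = list_encode (x # xs)"
  by (simp add: cons_code_def)

lemma list_encode_eq_0: "list_encode xs = 0 \<longleftrightarrow> xs = []"
  by (cases xs) auto

lemmas list_code_simps = hd_code drop_code cons_code list_encode_eq_0 list_encode_eq

lemma computable_hd_code: "total_computable k f \<Longrightarrow> total_computable k (\<lambda>xs. hd_code (f xs))"
  unfolding hd_code_def by (intro computable_fst computable_intros)

lemma computable_cons_code:
  "total_computable k f \<Longrightarrow> total_computable k g \<Longrightarrow> total_computable k (\<lambda>xs. cons_code (f xs) (g xs))"
  unfolding cons_code_def by (intro computable_pair computable_intros)

lemma computable_drop_code:
  "total_computable k f \<Longrightarrow> total_computable k g \<Longrightarrow> total_computable k (\<lambda>xs. drop_code (f xs) (g xs))"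
  unfolding drop_code_def by (intro computable_rec computable_snd computable_intros)

definition mem_code :: "nat \<Rightarrow> nat \<Rightarrow> bool" where
  "mem_code z c \<longleftrightarrow> (\<exists>i < c. drop_code i c \<noteq> 0 \<and> hd_code (drop_code i c) = z)"

lemma length_le_list_encode: "length xs \<le> list_encode xs"
proof (induction xs)
  case (Cons x xs)
  then show ?case using le_prod_encode_2[of "list_encode xs" x] by simp
qed simp

lemma mem_code: "mem_code z (list_encode L) \<longleftrightarrow> z \<in> set L"
proof -
  have "mem_code z (list_encode L) \<longleftrightarrow> (\<exists>i < list_encode L. i < length L \<and> L ! i = z)"
    unfolding mem_code_def drop_code list_encode_eq_0
    by (auto simp: hd_code hd_drop_conv_nth)
  also have "\<dots> \<longleftrightarrow> z \<in> set L"
    using length_le_list_encode[of L] by (metis in_set_conv_nth order_less_le_trans)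
  finally show ?thesis .
qed

lemma less_list_encode: "z \<in> set L \<Longrightarrow> z < list_encode L"
proof (induction L)
  case (Cons x L)
  have "x \<le> prod_encode (x, list_encode L)" "list_encode L \<le> prod_encode (x, list_encode L)"
    by (rule le_prod_encode_1 le_prod_encode_2)+
  with Cons show ?case by fastforce
qed simp

lemma decidable_mem_code:
  "total_computable k f \<Longrightarrow> total_computable k g \<Longrightarrow> decidable k (\<lambda>xs. mem_code (f xs) (g xs))"
  unfolding mem_code_def
  by (rule decidable_subst2[where P = "\<lambda>z c. \<exists>i < c. drop_code i c \<noteq> 0 \<and> hd_code (drop_code i c) = z"])
     (intro computable_drop_code computable_hd_code computable_intros)


section \<open>Certificates for evaluations\<close>

fun encode :: "recf \<Rightarrow> nat" where
  "encode Zero = prod_encode (0, 0)"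
| "encode Succ = prod_encode (1, 0)"
| "encode (Proj i) = prod_encode (2, i)"
| "encode (Comp f gs) = prod_encode (3, prod_encode (encode f, list_encode (map encode gs)))"
| "encode (Prec f g) = prod_encode (4, prod_encode (encode f, encode g))"
| "encode (Mu f) = prod_encode (5, encode f)"

text \<open>
  The code of the assertion that the program with code \<open>p\<close> halts on \<open>xs\<close> with value \<open>y\<close>. Here
  \<open>p\<close> ranges over all numbers, not only over codes of programs, which spares a test for being
  one.\<close>

definition eval_code :: "nat \<Rightarrow> nat list \<Rightarrow> nat \<Rightarrow> nat" where
  "eval_code p xs y = prod_encode (p, prod_encode (list_encode xs, y))"

lemma eval_code_eq_iff: "eval_code p xs y = eval_code p' xs' y' \<longleftrightarrow> p = p' \<and> xs = xs' \<and> y = y'"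
  by (simp add: eval_code_def list_encode_eq)

lemma eval_code_ge: "list_encode xs \<le> eval_code p xs y" "y \<le> eval_code p xs y"
  unfolding eval_code_def by (meson le_prod_encode_1 le_prod_encode_2 order_trans)+

text \<open>
  One application of a rule for \<open>eval\<close>, with the premises drawn from the set \<open>F\<close> of codes of
  assertions. Unlike \<open>eval\<close> this is not recursive, which is what makes it decidable for finite
  \<open>F\<close>.\<close>

inductive eval_step :: "nat set \<Rightarrow> nat \<Rightarrow> nat list \<Rightarrow> nat \<Rightarrow> bool" for F where
  zero: "eval_step F (prod_encode (0, 0)) xs 0"
| succ: "eval_step F (prod_encode (1, 0)) [x] (Suc x)"
| proj: "i < length xs \<Longrightarrow> eval_step F (prod_encode (2, i)) xs (xs ! i)"
| comp: "list_all2 (\<lambda>g y. eval_code g xs y \<in> F) gs ys \<Longrightarrow> eval_code f ys z \<in> F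
    \<Longrightarrow> eval_step F (prod_encode (3, prod_encode (f, list_encode gs))) xs z"
| prec_0: "eval_code f xs y \<in> F \<Longrightarrow> eval_step F (prod_encode (4, prod_encode (f, g))) (0 # xs) y"
| prec_Suc: "eval_code (prod_encode (4, prod_encode (f, g))) (n # xs) r \<in> F
    \<Longrightarrow> eval_code g (n # r # xs) y \<in> F
    \<Longrightarrow> eval_step F (prod_encode (4, prod_encode (f, g))) (Suc n # xs) y"
| mu: "eval_code f (n # xs) 0 \<in> F \<Longrightarrow> (\<forall>m<n. \<exists>y. eval_code f (m # xs) (Suc y) \<in> F)
    \<Longrightarrow> eval_step F (prod_encode (5, f)) xs n"

lemma eval_step_mono:
  assumes "eval_step F p xs y" "F \<subseteq> G" shows "eval_step G p xs y"
  using assms(1)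
proof cases
  case (comp gs ys f)
  have "list_all2 (\<lambda>g y. eval_code g xs y \<in> G) gs ys"
    using comp(2) by (rule list_all2_mono) (use assms(2) in auto)
  with comp assms(2) show ?thesis by (auto intro: eval_step.comp)
next
  case (mu f)
  with assms(2) show ?thesis by (metis eval_step.mu subsetD)
qed (use assms(2) in \<open>auto simp del: One_nat_def intro: eval_step.intros\<close>)

text \<open>
  A derivation flattened to a list: every entry follows by one rule from entries after it.\<close>

fun certificate :: "nat list \<Rightarrow> bool" where
  "certificate [] \<longleftrightarrow> True"
| "certificate (z # L) \<longleftrightarrow>
     (\<exists>p xs y. z = eval_code p xs y \<and> eval_step (set L) p xs y) \<and> certificate L"

lemma eval_step_sound:
  assumes "eval_step F (encode p) xs y"
    and F: "\<And>q us v. eval_code (encode q) us v \<in> F \<Longrightarrow> eval q us v"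
  shows "eval p xs y"
proof (cases p)
  case Zero
  with assms(1) show ?thesis by (auto elim!: eval_step.cases intro: eval.zero)
next
  case Succ
  with assms(1) show ?thesis by (auto elim!: eval_step.cases intro: eval.succ)
next
  case (Proj i)
  with assms(1) show ?thesis by (auto elim!: eval_step.cases intro: eval.proj)
next
  case (Comp f gs)
  with assms(1) obtain ys where "list_all2 (\<lambda>g y. eval_code g xs y \<in> F) (map encode gs) ys"
      and f: "eval_code (encode f) ys y \<in> F"
    by (auto elim!: eval_step.cases simp: list_encode_eq)
  then have "list_all2 (\<lambda>g y. eval g xs y) gs ys"
    by (auto simp: list_all2_conv_all_nth intro: F)
  then show ?thesis unfolding Comp using F[OF f] by (rule eval.comp)
next
  case (Prec f g)
  from assms(1) Prec consider
    us where "xs = 0 # us" "eval_code (encode f) us y \<in> F"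
  | n us r where "xs = Suc n # us" "eval_code (encode (Prec f g)) (n # us) r \<in> F"
      "eval_code (encode g) (n # r # us) y \<in> F"
    by (auto elim!: eval_step.cases)
  then show ?thesis unfolding Prec
    by cases (auto simp del: encode.simps intro: eval.prec_0 eval.prec_Suc dest!: F)
next
  case (Mu f)
  with assms(1) have "eval_code (encode f) (y # xs) 0 \<in> F"
      "\<forall>m<y. \<exists>v. eval_code (encode f) (m # xs) (Suc v) \<in> F"
    by (auto elim!: eval_step.cases)
  then show ?thesis unfolding Mu by (intro eval.mu) (auto dest: F)
qed

lemma certificate_sound: "certificate L \<Longrightarrow> eval_code (encode p) xs y \<in> set L \<Longrightarrow> eval p xs y"
proof (induction L arbitrary: p xs y)
  case (Cons z L)
  then have IH: "\<And>q us v. eval_code (encode q) us v \<in> set L \<Longrightarrow> eval q us v" by simp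
  show ?case
  proof (cases "eval_code (encode p) xs y \<in> set L")
    case False
    with Cons.prems have "eval_step (set L) (encode p) xs y" by (auto simp: eval_code_eq_iff)
    then show ?thesis by (rule eval_step_sound) (rule IH)
  qed (rule IH)
qed simp

definition certified :: "nat \<Rightarrow> bool" where
  "certified z \<longleftrightarrow> (\<exists>L. certificate L \<and> z \<in> set L)"

lemma certificate_append: "certificate K \<Longrightarrow> certificate L \<Longrightarrow> certificate (K @ L)"
  by (induction K) (auto intro: eval_step_mono)

text \<open>
  Certificates of several assertions can be concatenated, since a longer tail only offers more
  premises. This is how the premises of a rule are collected.\<close>

lemma certificate_covering:
  assumes "finite F" "\<forall>z \<in> F. certified z" shows "\<exists>L. certificate L \<and> F \<subseteq> set L"
  using assms
proof (induction rule: finite_induct)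
  case empty
  then show ?case by (intro exI[of _ "[]"]) simp
next
  case (insert z F)
  then obtain K L where "certificate K" "z \<in> set K" "certificate L" "F \<subseteq> set L"
    unfolding certified_def by auto
  then show ?case by (intro exI[of _ "K @ L"]) (auto intro: certificate_append)
qed

lemma certified_step:
  assumes "eval_step F p xs y" "finite F" "\<forall>z \<in> F. certified z" shows "certified (eval_code p xs y)"
proof -
  from certificate_covering[OF assms(2,3)] obtain L where L: "certificate L" "F \<subseteq> set L" by blast
  then have "certificate (eval_code p xs y # L)" using eval_step_mono[OF assms(1) L(2)]
    by (auto simp: eval_code_eq_iff)
  then show ?thesis unfolding certified_def by (meson list.set_intros(1))
qed

lemma certificate_complete: "eval p xs y \<Longrightarrow> certified (eval_code (encode p) xs y)"
proof (induction rule: eval.induct)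
  case (zero xs)
  show ?case by (rule certified_step[of "{}"]) (auto intro: eval_step.zero)
next
  case (succ x)
  show ?case by (rule certified_step[of "{}"]) (auto simp del: One_nat_def intro: eval_step.succ)
next
  case (proj i xs)
  then show ?case by (intro certified_step[of "{}"]) (auto intro: eval_step.proj)
next
  case (comp xs gs ys f z)
  let ?F = "insert (eval_code (encode f) ys z)
    ((\<lambda>i. eval_code (encode (gs ! i)) xs (ys ! i)) ` {..<length gs})"
  have "list_all2 (\<lambda>g y. eval_code g xs y \<in> ?F) (map encode gs) ys"
    using comp.IH(1) by (auto simp: list_all2_conv_all_nth)
  then have "eval_step ?F (encode (Comp f gs)) xs z"
    by (auto intro: eval_step.comp)
  then show ?case
    using comp.IH by (rule_tac certified_step[of ?F]) (auto simp: list_all2_conv_all_nth)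
next
  case (prec_0 f xs y g)
  then show ?case
    by (intro certified_step[of "{eval_code (encode f) xs y}"]) (auto intro: eval_step.prec_0)
next
  case (prec_Suc f g n xs r y)
  then show ?case
    by (intro certified_step[of "{eval_code (encode (Prec f g)) (n # xs) r,
          eval_code (encode g) (n # r # xs) y}"])
       (auto intro: eval_step.prec_Suc)
next
  case (mu f n xs)
  then obtain v where v: "\<forall>m<n. certified (eval_code (encode f) (m # xs) (Suc (v m)))" by metis
  let ?F = "insert (eval_code (encode f) (n # xs) 0)
    ((\<lambda>m. eval_code (encode f) (m # xs) (Suc (v m))) ` {..<n})"
  have "eval_step ?F (encode (Mu f)) xs n" by (auto intro: eval_step.mu)
  then show ?case using mu.IH(1) v by (rule_tac certified_step[of ?F]) auto
qed

definition certifies :: "nat \<Rightarrow> nat \<Rightarrow> nat \<Rightarrow> nat \<Rightarrow> bool" where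
  "certifies c e x y \<longleftrightarrow> certificate (list_decode c) \<and> eval_code e [x] y \<in> set (list_decode c)"

text \<open>
  The normal form: halting with a given value is the projection of a relation that is decidable
  uniformly in the program, by \<open>decidable4_certifies\<close> below.\<close>

lemma eval_iff_certifies: "eval p [x] y \<longleftrightarrow> (\<exists>c. certifies c (encode p) x y)"
proof
  assume "eval p [x] y"
  then obtain L where "certificate L" "eval_code (encode p) [x] y \<in> set L"
    using certificate_complete unfolding certified_def by blast
  then have "certifies (list_encode L) (encode p) x y" by (simp add: certifies_def)
  then show "\<exists>c. certifies c (encode p) x y" ..
qed (auto simp: certifies_def intro: certificate_sound)

text \<open>
  The relation \<open>eval_step\<close> on codes, one disjunct for each rule. Every quantifier is bounded: a
  part of a code is at most the code, and whatever occurs in an assertion listed in \<open>c\<close> is less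
  than \<open>c\<close>.\<close>

definition eval_step_code :: "nat \<Rightarrow> nat \<Rightarrow> nat \<Rightarrow> nat \<Rightarrow> bool" where
  "eval_step_code c p xs y \<longleftrightarrow>
     p = prod_encode (0, 0) \<and> y = 0 \<or>
     p = prod_encode (1, 0) \<and> (\<exists>x < y. xs = cons_code x 0 \<and> y = Suc x) \<or>
     (\<exists>i < Suc p. p = prod_encode (2, i) \<and> drop_code i xs \<noteq> 0 \<and> y = hd_code (drop_code i xs)) \<or>
     (\<exists>f < Suc p. \<exists>gs < Suc p. p = prod_encode (3, prod_encode (f, gs)) \<and>
        (\<exists>ys < c. mem_code (prod_encode (f, prod_encode (ys, y))) c \<and>
          (\<forall>i < Suc (gs + ys). (drop_code i gs = 0 \<longleftrightarrow> drop_code i ys = 0) \<and>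
            (drop_code i gs \<noteq> 0 \<longrightarrow>
              mem_code (prod_encode (hd_code (drop_code i gs),
                prod_encode (xs, hd_code (drop_code i ys)))) c)))) \<or>
     (\<exists>f < Suc p. \<exists>g < Suc p. p = prod_encode (4, prod_encode (f, g)) \<and> xs \<noteq> 0 \<and>
        (hd_code xs = 0 \<and> mem_code (prod_encode (f, prod_encode (drop_code 1 xs, y))) c \<or>
         hd_code xs \<noteq> 0 \<and> (\<exists>r < c.
           mem_code (prod_encode (p, prod_encode (cons_code (hd_code xs - 1) (drop_code 1 xs), r))) c \<and>
           mem_code (prod_encode (g, prod_encode (
             cons_code (hd_code xs - 1) (cons_code r (drop_code 1 xs)), y))) c))) \<or>
     (\<exists>f < Suc p. p = prod_encode (5, f) \<and>
        mem_code (prod_encode (f, prod_encode (cons_code y xs, 0))) c \<and>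
        (\<forall>m < y. \<exists>v < c. mem_code (prod_encode (f, prod_encode (cons_code m xs, Suc v))) c))"

lemma decidable4_eval_step_code: "decidable4 eval_step_code"
  unfolding eval_step_code_def
  by (intro computable_intros decidable_mem_code computable_pair computable_cons_code
      computable_hd_code computable_drop_code)

text \<open>
  Comparing tails avoids computing lengths. The range of \<open>i\<close> covers every position, as the code
  of a list is at least its length.\<close>

lemma list_all2_iff_drop:
  "list_all2 R us vs \<longleftrightarrow> (\<forall>i < Suc (list_encode us + list_encode vs).
     (drop i us = [] \<longleftrightarrow> drop i vs = []) \<and> (drop i us \<noteq> [] \<longrightarrow> R (hd (drop i us)) (hd (drop i vs))))"
  (is "?L \<longleftrightarrow> ?R")
proof
  assume ?L
  then show ?R by (auto simp: list_all2_conv_all_nth hd_drop_conv_nth)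
next
  assume R: ?R
  have le: "length us \<le> list_encode us" "length vs \<le> list_encode vs"
    by (rule length_le_list_encode)+
  from R[rule_format, of "length us"] R[rule_format, of "length vs"] le
  have eq: "length us = length vs" by auto
  have "R (us ! i) (vs ! i)" if "i < length us" for i
    using R[rule_format, of i] that eq le by (auto simp: hd_drop_conv_nth)
  with eq show ?L by (simp add: list_all2_conv_all_nth)
qed

lemma tag_components_le:
  "i < Suc (prod_encode (t, i))" "f < Suc (prod_encode (t, prod_encode (f, g)))"
  "g < Suc (prod_encode (t, prod_encode (f, g)))"
  using le_prod_encode_1 le_prod_encode_2 by (meson le_imp_less_Suc order_trans)+

lemma eval_step_code_iff:
  "eval_step_code (list_encode L) p (list_encode xs) y \<longleftrightarrow> eval_step (set L) p xs y"
proof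
  have comp: "eval_step (set L) (prod_encode (3, prod_encode (f, list_encode gs))) xs y"
    if "eval_code f ys y \<in> set L" and
      "\<forall>i < Suc (list_encode gs + list_encode ys). (drop i gs = [] \<longleftrightarrow> drop i ys = []) \<and>
        (drop i gs \<noteq> [] \<longrightarrow> eval_code (hd (drop i gs)) xs (hd (drop i ys)) \<in> set L)" for f gs ys
    using that by (intro eval_step.comp[where gs = gs and ys = ys]) (auto simp: list_all2_iff_drop)
  assume "eval_step_code (list_encode L) p (list_encode xs) y"
  then show "eval_step (set L) p xs y"
    unfolding eval_step_code_def
  proof (elim disjE exE conjE, goal_cases)
    case 1
    then show ?thesis by (auto intro: eval_step.zero)
  next
    case (2 x)
    then have "xs = [x]" using cons_code[of x "[]"] list_encode_eq[of xs "[x]"] by simp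
    with 2 show ?thesis by (auto simp del: One_nat_def intro: eval_step.succ)
  next
    case (3 i)
    then show ?thesis
      by (auto simp: list_code_simps hd_drop_conv_nth not_le intro: eval_step.proj)
  next
    case (4 f gs ys)
    obtain gs' ys' where [simp]: "gs = list_encode gs'" "ys = list_encode ys'"
      by (metis list_decode_inverse)
    show ?thesis
      using 4 comp[of f ys' gs'] unfolding eval_code_def
      by (auto simp: list_code_simps mem_code cong: conj_cong)
  next
    case (5 f g)
    then show ?thesis
      by (cases xs) (auto simp: list_code_simps mem_code eval_code_def simp del: list_encode.simps
          intro: eval_step.prec_0)
  next
    case (6 f g r)
    then obtain n us where "xs = Suc n # us"
      by (cases xs; cases "hd xs") (auto simp: list_code_simps simp del: list_encode.simps)
    with 6 show ?thesis
      by (auto simp: list_code_simps mem_code simp del: list_encode.simps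
          intro!: eval_step.prec_Suc[where r = r] simp: eval_code_def)
  next
    case (7 f)
    then show ?thesis
      by (auto simp: list_code_simps mem_code eval_code_def simp del: list_encode.simps
          intro!: eval_step.mu) blast
  qed
next
  have bound: "list_encode us < list_encode L" "v < list_encode L"
    if "eval_code q us v \<in> set L" for q us v
    using less_list_encode[OF that] eval_code_ge order.strict_trans1 by blast+
  assume "eval_step (set L) p xs y"
  then show "eval_step_code (list_encode L) p (list_encode xs) y"
  proof cases
    case zero
    then show ?thesis by (simp add: eval_step_code_def)
  next
    case (succ x)
    then show ?thesis by (simp add: eval_step_code_def cons_code_def)
  next
    case (proj i)
    then have "\<exists>i < Suc p. p = prod_encode (2, i) \<and> drop_code i (list_encode xs) \<noteq> 0 \<and>
        y = hd_code (drop_code i (list_encode xs))"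
      by (intro exI[of _ i]) (auto simp: list_code_simps hd_drop_conv_nth tag_components_le)
    then show ?thesis unfolding eval_step_code_def by blast
  next
    case (comp gs ys f)
    have "\<exists>f < Suc p. \<exists>gs < Suc p. p = prod_encode (3, prod_encode (f, gs)) \<and>
        (\<exists>ys < list_encode L. mem_code (prod_encode (f, prod_encode (ys, y))) (list_encode L) \<and>
          (\<forall>i < Suc (gs + ys). (drop_code i gs = 0 \<longleftrightarrow> drop_code i ys = 0) \<and>
            (drop_code i gs \<noteq> 0 \<longrightarrow>
              mem_code (prod_encode (hd_code (drop_code i gs),
                prod_encode (list_encode xs, hd_code (drop_code i ys)))) (list_encode L))))"
      using comp bound[OF comp(3)]
      by (intro exI[of _ f] exI[of _ "list_encode gs"] exI[of _ "list_encode ys"] conjI)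
         (auto simp: tag_components_le list_all2_iff_drop list_code_simps mem_code eval_code_def
           cong: conj_cong)
    then show ?thesis unfolding eval_step_code_def by blast
  next
    case (prec_0 f us g)
    then have "\<exists>f < Suc p. \<exists>g < Suc p. p = prod_encode (4, prod_encode (f, g)) \<and> list_encode xs \<noteq> 0 \<and>
        hd_code (list_encode xs) = 0 \<and>
        mem_code (prod_encode (f, prod_encode (drop_code 1 (list_encode xs), y))) (list_encode L)"
      by (intro exI[of _ f] exI[of _ g] conjI)
         (auto simp: tag_components_le list_code_simps mem_code eval_code_def
           simp del: list_encode.simps)
    then show ?thesis unfolding eval_step_code_def by blast
  next
    case (prec_Suc f g n us r)
    then have "\<exists>f < Suc p. \<exists>g < Suc p. p = prod_encode (4, prod_encode (f, g)) \<and> list_encode xs \<noteq> 0 \<and>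
        hd_code (list_encode xs) \<noteq> 0 \<and> (\<exists>r < list_encode L.
        mem_code (prod_encode (p, prod_encode (cons_code (hd_code (list_encode xs) - 1)
         (drop_code 1 (list_encode xs)), r))) (list_encode L) \<and>
        mem_code (prod_encode (g, prod_encode (cons_code (hd_code (list_encode xs) - 1)
         (cons_code r (drop_code 1 (list_encode xs))), y))) (list_encode L))"
      using bound[OF prec_Suc(3)]
      by (intro exI[of _ f] exI[of _ g] exI[of _ r] conjI)
         (auto simp: tag_components_le list_code_simps mem_code eval_code_def
           simp del: list_encode.simps)
    then show ?thesis unfolding eval_step_code_def by blast
  next
    case (mu f)
    then have "\<exists>v < list_encode L. eval_code f (m # xs) (Suc v) \<in> set L" if "m < y" for m
      using that bound(2) by (meson Suc_lessD)
    with mu have "\<exists>f < Suc p. p = prod_encode (5, f) \<and>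
        mem_code (prod_encode (f, prod_encode (cons_code y (list_encode xs), 0))) (list_encode L) \<and>
        (\<forall>m < y. \<exists>v < list_encode L.
          mem_code (prod_encode (f, prod_encode (cons_code m (list_encode xs), Suc v))) (list_encode L))"
      by (intro exI[of _ f])
         (auto simp: tag_components_le list_code_simps mem_code eval_code_def
           simp del: list_encode.simps)
    then show ?thesis unfolding eval_step_code_def by blast
  qed
qed

lemma certificate_iff_drop:
  "certificate L \<longleftrightarrow> (\<forall>i < length L. \<exists>p xs y. L ! i = eval_code p xs y \<and>
     eval_step (set (drop (Suc i) L)) p xs y)"
proof (induction L)
  case (Cons z L)
  have "(\<forall>i < length (z # L). Q i) \<longleftrightarrow> Q 0 \<and> (\<forall>i < length L. Q (Suc i))" for Q
    by (auto simp: less_Suc_eq_0_disj)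
  then show ?case using Cons by simp
qed simp

text \<open>
  Every number codes a list of codes of assertions, so being a certificate can be checked position
  by position, without first testing the shape of the number.\<close>

lemma decidable4_certifies: "decidable4 certifies"
proof -
  \<comment> \<open>\<open>?h\<close> splits off the program of the entry at position \<open>i\<close>; \<open>?t\<close> is the pair of its arguments and value\<close>
  let ?h = "\<lambda>i c. prod_decode (hd_code (drop_code i c))"
  let ?t = "\<lambda>i c. prod_decode (snd (?h i c))"
  let ?S = "\<lambda>i c. eval_step_code (drop_code (Suc i) c) (fst (?h i c)) (fst (?t i c)) (snd (?t i c))"
  have step: "?S i (list_encode L) \<longleftrightarrow>
      (\<exists>p xs y. L ! i = eval_code p xs y \<and> eval_step (set (drop (Suc i) L)) p xs y)"
    if "i < length L" for i L
  proof -
    obtain p us y where z: "L ! i = prod_encode (p, prod_encode (us, y))"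
      by (metis prod_decode_inverse surj_pair)
    obtain xs where [simp]: "us = list_encode xs" by (metis list_decode_inverse)
    have "L ! i = eval_code p xs y" using z by (simp add: eval_code_def)
    then have "(\<exists>p xs y. L ! i = eval_code p xs y \<and> eval_step (set (drop (Suc i) L)) p xs y)
        \<longleftrightarrow> eval_step (set (drop (Suc i) L)) p xs y"
      by (auto simp: eval_code_eq_iff)
    also have "\<dots> \<longleftrightarrow> ?S i (list_encode L)"
      using that z by (simp add: list_code_simps hd_drop_conv_nth eval_step_code_iff)
    finally show ?thesis ..
  qed
  have cert: "certificate L \<longleftrightarrow> (\<forall>i < list_encode L.
      drop_code i (list_encode L) \<noteq> 0 \<longrightarrow> ?S i (list_encode L))"
    for L
    unfolding certificate_iff_drop using step length_le_list_encode[of L]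
    by (auto simp: drop_code list_encode_eq_0)
  have "certifies c e x y \<longleftrightarrow> (\<forall>i < c. drop_code i c \<noteq> 0 \<longrightarrow> ?S i c) \<and>
      mem_code (prod_encode (e, prod_encode (cons_code x 0, y))) c" for c e x y
    using cert[of "list_decode c"] mem_code[of _ "list_decode c"]
    by (simp add: certifies_def eval_code_def cons_code_def)
  then show ?thesis
    by (simp only:) (intro computable_intros decidable_subst4[OF decidable4_eval_step_code]
        decidable_mem_code computable_pair computable_cons_code computable_hd_code
        computable_drop_code computable_fst computable_snd)
qed


section \<open>Sets of asymptotic density one\<close>

lemma has_density_1_iff:
  "has_density S 1 \<longleftrightarrow> (\<lambda>n. real (card ({0..n} - S)) / real (n + 1)) \<longlonglongrightarrow> 0"
proof -
  have eq: "real (card ({0..n} - S)) / real (n + 1) = 1 - real (card (S \<inter> {0..n})) / real (n + 1)" for n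
  proof -
    have "card {0..n} = card (S \<inter> {0..n}) + card ({0..n} - S)"
      by (metis card_Int_Diff finite_atLeastAtMost inf_commute)
    then show ?thesis by (simp add: field_simps)
  qed
  have "X \<longlonglongrightarrow> 1 \<longleftrightarrow> (\<lambda>n. 1 - X n) \<longlonglongrightarrow> 0" for X :: "nat \<Rightarrow> real"
    using tendsto_diff[OF tendsto_const[of "1 :: real"], of X 1 sequentially]
      tendsto_diff[OF tendsto_const[of "1 :: real"], of "\<lambda>n. 1 - X n" 0 sequentially] by auto
  then show ?thesis unfolding eq has_density_def .
qed

lemma has_density_1_Int:
  assumes "has_density S 1" "has_density T 1" shows "has_density (S \<inter> T) 1"
  unfolding has_density_1_iff
proof (rule tendsto_sandwich[OF _ _ tendsto_const])
  show "(\<lambda>n. real (card ({0..n} - S)) / real (n + 1) + real (card ({0..n} - T)) / real (n + 1)) \<longlonglongrightarrow> 0"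
    using tendsto_add[OF assms[unfolded has_density_1_iff]] by simp
  have "card ({0..n} - S \<inter> T) \<le> card ({0..n} - S) + card ({0..n} - T)" for n
    by (simp add: Diff_Int card_Un_le)
  then show "\<forall>\<^sub>F n in sequentially. real (card ({0..n} - S \<inter> T)) / real (n + 1)
      \<le> real (card ({0..n} - S)) / real (n + 1) + real (card ({0..n} - T)) / real (n + 1)"
    unfolding add_divide_distrib[symmetric]
    by (intro always_eventually allI divide_right_mono) (simp_all flip: of_nat_add)
qed auto

text \<open>
  At most \<open>log 2 (n + 1) + 1\<close> indices \<open>k\<close> have \<open>F k \<le> n\<close>, because \<open>h\<close> maps them injectively to
  numbers \<open>j\<close> with \<open>2 ^ j \<le> n\<close>.\<close>

lemma has_density_1_sparse_complement:
  assumes inj: "inj_on h D" and F: "\<And>k. k \<in> D \<Longrightarrow> 2 ^ h k \<le> F k"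
  shows "has_density (- F ` D) 1"
  unfolding has_density_1_iff
proof (rule tendsto_sandwich[OF _ _ tendsto_const])
  show "(\<lambda>n. (log 2 (real n + 1) + 1) / real (n + 1)) \<longlonglongrightarrow> 0" by real_asymp
  have "real (card ({0..n} - - F ` D)) \<le> log 2 (real n + 1) + 1" for n
  proof -
    let ?K = "{k \<in> D. F k \<le> n}"
    have sub: "h ` ?K \<subseteq> {..nat \<lfloor>log 2 (real n + 1)\<rfloor>}"
    proof (intro image_subsetI)
      fix k assume k: "k \<in> ?K"
      then have "2 ^ h k \<le> n" using F[of k] by auto
      then have "real (2 ^ h k) \<le> real n" by (simp only: of_nat_le_iff)
      then have "(2 :: real) ^ h k \<le> real n + 1" unfolding of_nat_power of_nat_numeral by linarith
      then have "real (h k) \<le> log 2 (real n + 1)" by (simp add: le_log_iff powr_realpow)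
      then show "h k \<in> {..nat \<lfloor>log 2 (real n + 1)\<rfloor>}" by (simp add: le_nat_floor)
    qed
    have inj': "inj_on h ?K" by (rule inj_on_subset[OF inj]) auto
    have fin: "finite ?K" using sub inj' finite_imageD finite_subset by blast
    have "{0..n} - - F ` D = F ` ?K" by auto
    then have "card ({0..n} - - F ` D) \<le> card ?K" using card_image_le[OF fin] by simp
    also have "\<dots> \<le> card {..nat \<lfloor>log 2 (real n + 1)\<rfloor>}"
      using inj' sub by (rule card_inj_on_le) simp
    finally have "real (card ({0..n} - - F ` D)) \<le> real (Suc (nat \<lfloor>log 2 (real n + 1)\<rfloor>))"
      unfolding of_nat_le_iff card_atMost .
    also have "\<dots> \<le> log 2 (real n + 1) + 1" by (simp add: of_nat_floor)
    finally show ?thesis .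
  qed
  then show "\<forall>\<^sub>F n in sequentially. real (card ({0..n} - - F ` D)) / real (n + 1)
      \<le> (log 2 (real n + 1) + 1) / real (n + 1)"
    by (intro always_eventually allI divide_right_mono) auto
qed auto

text \<open>
  Otherwise the progression lies in the complement of \<open>S\<close>, which would then have at least
  \<open>m + 1\<close> elements up to \<open>a + d * m\<close>, a proportion tending to \<open>1 / d\<close>.\<close>

lemma has_density_1_meets_progression:
  assumes "has_density S 1" "d > 0" shows "\<exists>m. a + d * m \<in> S"
proof (rule ccontr)
  assume no: "\<nexists>m. a + d * m \<in> S"
  have "(\<lambda>m. real (card ({0..a + d * m} - S)) / real (a + d * m + 1)) \<longlonglongrightarrow> 0"
    using assms(1)[unfolded has_density_1_iff]
    by (rule filterlim_compose[where g = "\<lambda>n. real (card ({0..n} - S)) / real (n + 1)"])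
       (use assms(2) in \<open>auto intro!: filterlim_subseq simp: strict_mono_def\<close>)
  moreover have "(\<lambda>m. (real m + 1) / (real a + real d * real m + 1)) \<longlonglongrightarrow> inverse (real d)"
    using assms(2) by real_asymp
  moreover have "(real m + 1) / (real a + real d * real m + 1)
      \<le> real (card ({0..a + d * m} - S)) / real (a + d * m + 1)" for m
  proof -
    have "card {..m} = card ((\<lambda>i. a + d * i) ` {..m})"
      using assms(2) by (intro card_image[symmetric]) (auto simp: inj_on_def)
    also have "\<dots> \<le> card ({0..a + d * m} - S)"
      using no by (intro card_mono) auto
    finally show ?thesis by (auto simp: divide_right_mono add_ac)
  qed
  ultimately have "inverse (real d) \<le> 0" by (intro LIMSEQ_le) auto
  then show False using assms(2) by simp
qed

lemma infinite_of_density_1: "has_density S 1 \<Longrightarrow> infinite S"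
proof
  assume "has_density S 1" "finite S"
  then obtain b where b: "\<forall>x \<in> S. x < b" using finite_nat_set_iff_bounded by blast
  from has_density_1_meets_progression[OF \<open>has_density S 1\<close>, of 1 b] b show False by fastforce
qed


section \<open>Structures given by a matching\<close>

text \<open>
  Both structures arise by declaring the pairs \<open>{f k, g k}\<close> for \<open>k \<in> D\<close> to be the classes of
  size two.\<close>

locale matching =
  fixes D :: "nat set" and f g :: "nat \<Rightarrow> nat"
  assumes inj_f: "inj_on f D" and inj_g: "inj_on g D" and disjoint: "f ` D \<inter> g ` D = {}"
begin

definition pairing :: "nat rel" where
  "pairing = {(x, y). x = y \<or> (\<exists>k \<in> D. x = f k \<and> y = g k \<or> y = f k \<and> x = g k)}"

lemma class_f: "k \<in> D \<Longrightarrow> pairing `` {f k} = {f k, g k}"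
  using inj_f disjoint by (auto simp: pairing_def inj_on_def)

lemma class_g: "k \<in> D \<Longrightarrow> pairing `` {g k} = {f k, g k}"
  using inj_g disjoint by (auto simp: pairing_def inj_on_def)

lemma class_unpaired: "x \<notin> f ` D \<union> g ` D \<Longrightarrow> pairing `` {x} = {x}"
  by (auto simp: pairing_def)

lemma f_neq_g: "k \<in> D \<Longrightarrow> f k \<noteq> g k"
  using disjoint by auto

lemma equiv_pairing: "equiv UNIV pairing"
proof (rule equivI)
  show "trans pairing"
  proof (rule transI)
    fix x y z assume xy: "(x, y) \<in> pairing" and yz: "(y, z) \<in> pairing"
    then have y: "y \<in> pairing `` {x}" and z: "z \<in> pairing `` {y}" by auto
    show "(x, z) \<in> pairing"
    proof (cases "x \<in> f ` D \<union> g ` D")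
      case True
      then obtain k where k: "k \<in> D" "x = f k \<or> x = g k" by auto
      then have "y = f k \<or> y = g k" using y class_f class_g by auto
      then have "z = f k \<or> z = g k" using z k class_f class_g by auto
      then have "z \<in> pairing `` {x}" using k class_f[of k] class_g[of k] by auto
      then show ?thesis by simp
    next
      case False
      then show ?thesis using y yz class_unpaired by auto
    qed
  qed
qed (auto simp: pairing_def refl_on_def sym_def)

lemma elements_of_size_1: "elements_of_size pairing 1 = - (f ` D \<union> g ` D)"
proof -
  have "x \<in> elements_of_size pairing 1 \<longleftrightarrow> x \<notin> f ` D \<union> g ` D" for x
  proof (cases "x \<in> f ` D \<union> g ` D")
    case True
    then obtain k where k: "k \<in> D" "pairing `` {x} = {f k, g k}" using class_f class_g by blast
    then show ?thesis using True f_neq_g by (simp add: elements_of_size_def)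
  next
    case False
    then show ?thesis using class_unpaired by (simp add: elements_of_size_def)
  qed
  then show ?thesis by blast
qed

lemma one_two_structure_pairing:
  assumes "infinite D" "infinite (- (f ` D \<union> g ` D))"
  shows "one_two_structure pairing"
  unfolding one_two_structure_def
proof (intro conjI ballI)
  show "infinite {c \<in> UNIV // pairing. card c = 1}"
  proof (rule infinite_super)
    show "(\<lambda>x. {x}) ` (- (f ` D \<union> g ` D)) \<subseteq> {c \<in> UNIV // pairing. card c = 1}"
      using class_unpaired by (auto simp: quotient_def)
    show "infinite ((\<lambda>x. {x}) ` (- (f ` D \<union> g ` D)))"
      using assms(2) by (subst finite_image_iff) auto
  qed
  show "infinite {c \<in> UNIV // pairing. card c = 2}"
  proof (rule infinite_super)
    show "(\<lambda>k. pairing `` {f k}) ` D \<subseteq> {c \<in> UNIV // pairing. card c = 2}"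
      using class_f f_neq_g by (auto simp: quotient_def)
    have "inj_on (\<lambda>k. pairing `` {f k}) D"
    proof (rule inj_onI)
      fix k l assume kl: "k \<in> D" "l \<in> D" "pairing `` {f k} = pairing `` {f l}"
      then have "f k \<in> {f l, g l}" using class_f by auto
      then show "k = l" using kl(1,2) inj_f disjoint by (auto simp: inj_on_def)
    qed
    then show "infinite ((\<lambda>k. pairing `` {f k}) ` D)"
      using assms(1) finite_image_iff by blast
  qed
  fix c assume "c \<in> UNIV // pairing"
  then obtain x where c: "c = pairing `` {x}" by (auto simp: quotient_def)
  show "card c = 1 \<or> card c = 2"
  proof (cases "x \<in> f ` D \<union> g ` D")
    case True
    then obtain k where "k \<in> D" "c = {f k, g k}" using c class_f class_g by blast
    then show ?thesis using f_neq_g by simp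
  next
    case False
    then show ?thesis using c class_unpaired by simp
  qed
qed (rule equiv_pairing)

text \<open>
  The bound \<open>k \<le> f k\<close> makes the search for the index of a pair finite.\<close>

lemma computable_pairing:
  assumes D: "decidable1 (\<lambda>k. k \<in> D)" and f: "computable1 f" and g: "computable1 g"
    and le: "\<And>k. k \<le> f k"
  shows "computable_equiv_structure pairing"
proof -
  have "(x, y) \<in> pairing \<longleftrightarrow>
      x = y \<or> (\<exists>k < Suc (x + y). k \<in> D \<and> (x = f k \<and> y = g k \<or> y = f k \<and> x = g k))" for x y
  proof -
    have "k < Suc (x + y)" if "x = f k \<or> y = f k" for k using le[of k] that by auto
    then show ?thesis unfolding pairing_def by blast
  qed
  then have "decidable2 (\<lambda>x y. (x, y) \<in> pairing)"
    by (simp only:)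
       (intro computable_intros decidable_subst1[OF D] computable_subst1[OF f] computable_subst1[OF g])
  then obtain p where "\<And>xs. length xs = Suc (Suc 0) \<Longrightarrow>
      eval p xs (if (hd xs, hd (tl xs)) \<in> pairing then 1 else 0)"
    unfolding decidable_def total_computable_def by blast
  from this[of "[_, _]"] have "eval p [x, y] (if (x, y) \<in> pairing then 1 else 0)" for x y
    by simp
  then have "computable_rel pairing" unfolding computable_rel_def by blast
  then show ?thesis by (simp add: computable_equiv_structure_def equiv_pairing)
qed

end

lemma isomorphism_elements_of_size:
  assumes "isomorphism A B f"
  shows "f x \<in> elements_of_size B k \<longleftrightarrow> x \<in> elements_of_size A k"
proof -
  have bij: "bij f" and AB: "\<And>x y. (x, y) \<in> A \<longleftrightarrow> (f x, f y) \<in> B"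
    using assms by (auto simp: isomorphism_def)
  have "B `` {f x} = f ` (A `` {x})"
  proof (rule set_eqI)
    fix y
    obtain z where y: "y = f z" using bij_pointE[OF bij] by metis
    have "z \<in> A `` {x} \<longleftrightarrow> f z \<in> f ` (A `` {x})" using bij by (simp add: bij_def inj_image_mem_iff)
    then show "y \<in> B `` {f x} \<longleftrightarrow> y \<in> f ` (A `` {x})" unfolding y using AB by simp
  qed
  moreover have "inj_on f (A `` {x})" using bij by (auto simp: bij_def intro: inj_on_subset)
  ultimately show ?thesis
    by (simp add: elements_of_size_def card_image finite_image_iff)
qed


section \<open>Diagonalization against all programs\<close>

text \<open>
  The numbers divisible by exactly \<open>2 ^ e\<close>, except \<open>2 ^ e\<close> itself. The columns are disjoint
  progressions; leaving out the powers of two reserves these as partners.\<close>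

definition column :: "nat \<Rightarrow> nat \<Rightarrow> nat" where "column e m = 2 ^ e * (2 * m + 3)"

lemma pow2_times_odd_cancel:
  fixes a b :: nat
  assumes "2 ^ i * a = 2 ^ j * b" "odd a" "odd b" shows "i = j"
  using assms(1)
proof (induction i arbitrary: j)
  case 0
  with assms show ?case by (cases j) auto
next
  case (Suc i)
  with assms show ?case by (cases j) auto
qed

lemma column_eqD: "column e m = column e' m' \<Longrightarrow> e = e'"
  unfolding column_def by (erule pow2_times_odd_cancel) auto

lemma column_neq_pow2: "column e m \<noteq> 2 ^ k"
proof
  assume "column e m = 2 ^ k"
  then have eq: "2 ^ e * (2 * m + 3) = 2 ^ k * (1 :: nat)" by (simp add: column_def)
  then have "e = k" by (rule pow2_times_odd_cancel) auto
  with eq show False by simp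
qed

text \<open>
  A number \<open>s\<close> is read as a stage \<open>(e, m, x, c)\<close>: \<open>c\<close> is offered as a certificate that program
  \<open>e\<close> maps \<open>x\<close> to the number with index \<open>m\<close> in column \<open>e\<close>.\<close>

definition program_part :: "nat \<Rightarrow> nat" where "program_part s = fst (prod_decode s)"
definition offset_part :: "nat \<Rightarrow> nat" where
  "offset_part s = fst (prod_decode (snd (prod_decode s)))"
definition input_part :: "nat \<Rightarrow> nat" where
  "input_part s = fst (prod_decode (snd (prod_decode (snd (prod_decode s)))))"
definition certificate_part :: "nat \<Rightarrow> nat" where
  "certificate_part s = snd (prod_decode (snd (prod_decode (snd (prod_decode s)))))"
definition target :: "nat \<Rightarrow> nat" where "target s = column (program_part s) (offset_part s)"

text \<open>
  The input must not be a power of two, that is, it must be an element of \<open>A(1)\<close>. An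
  isomorphism has to send it to an element of \<open>C(1)\<close>, so pairing off the target refutes the
  program. As \<open>k < 2 ^ k\<close>, the bounded search finds every power of two.\<close>

definition candidate :: "nat \<Rightarrow> bool" where
  "candidate s \<longleftrightarrow> (\<forall>k < Suc (input_part s). input_part s \<noteq> 2 ^ k) \<and>
     certifies (certificate_part s) (program_part s) (input_part s) (target s)"

text \<open>
  Only the first candidate for each program acts. One element of the range suffices to refute
  the program, and taking only one per column keeps \<open>C(2)\<close> sparse.\<close>

definition acting :: "nat set" where
  "acting = {s. candidate s \<and> (\<forall>t < s. candidate t \<longrightarrow> program_part t \<noteq> program_part s)}"

lemma computable1_target: "computable1 target"
  unfolding target_def column_def program_part_def offset_part_def
  by (intro computable_intros computable_fst computable_snd)

lemma decidable1_candidate: "decidable1 candidate"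
  unfolding candidate_def program_part_def input_part_def certificate_part_def
  by (intro computable_intros computable_fst computable_snd decidable_subst4[OF decidable4_certifies]
      computable_subst1[OF computable1_target])

lemma decidable1_acting: "decidable1 (\<lambda>s. s \<in> acting)"
  unfolding acting_def mem_Collect_eq program_part_def
  by (intro computable_intros computable_fst decidable_subst1[OF decidable1_candidate])

lemma inj_on_program_part: "inj_on program_part acting"
proof (rule inj_onI)
  fix s t assume "s \<in> acting" "t \<in> acting" "program_part s = program_part t"
  then show "s = t" by (cases s t rule: linorder_cases) (auto simp: acting_def)
qed

text \<open>
  The candidates for the program of \<open>\<theta>\<close> enumerate the part of \<open>\<theta>(A(1))\<close> that lies in its column.\<close>

lemma candidate_iff:
  "(\<exists>s. candidate s \<and> program_part s = encode p \<and> target s = y) \<longleftrightarrow>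
     (\<exists>m x. y = column (encode p) m \<and> x \<notin> range ((^) 2) \<and> eval p [x] y)"
proof
  assume "\<exists>s. candidate s \<and> program_part s = encode p \<and> target s = y"
  then obtain s where s: "candidate s" "program_part s = encode p" "target s = y" by blast
  have "input_part s \<notin> range ((^) 2)"
  proof
    assume "input_part s \<in> range ((^) 2)"
    then obtain k where "input_part s = 2 ^ k" by blast
    moreover have "k < 2 ^ k" by simp
    ultimately show False using s(1) unfolding candidate_def by (metis less_SucI)
  qed
  moreover have "eval p [input_part s] y"
    using s by (auto simp: candidate_def eval_iff_certifies)
  ultimately show "\<exists>m x. y = column (encode p) m \<and> x \<notin> range ((^) 2) \<and> eval p [x] y"
    using s by (auto simp: target_def)
next
  assume "\<exists>m x. y = column (encode p) m \<and> x \<notin> range ((^) 2) \<and> eval p [x] y"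
  then obtain m x c where "y = column (encode p) m" "x \<notin> range ((^) 2)" "certifies c (encode p) x y"
    using eval_iff_certifies by blast
  then show "\<exists>s. candidate s \<and> program_part s = encode p \<and> target s = y"
    by (intro exI[of _ "prod_encode (encode p, prod_encode (m, prod_encode (x, c)))"])
       (auto simp: candidate_def program_part_def input_part_def certificate_part_def target_def
          offset_part_def)
qed

lemma candidate_imp_acting:
  "candidate t \<Longrightarrow> \<exists>s \<in> acting. program_part s = program_part t"
proof (induction t rule: less_induct)
  case (less t)
  show ?case
  proof (cases "t \<in> acting")
    case False
    then obtain u where "u < t" "candidate u" "program_part u = program_part t"
      using less.prems by (auto simp: acting_def)
    with less.IH[of u] show ?thesis by simp
  qed auto
qed

text \<open>
  The identity has infinitely many programs, obtained by padding with unused arguments. Each of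
  them maps \<open>A(1)\<close> onto itself, so it meets its column and some stage acts for it.\<close>

lemma infinite_acting: "infinite acting"
proof
  assume "finite acting"
  define I where "I n = Comp (Proj 0) (Proj 0 # replicate n Zero)" for n
  have I: "eval (I n) [x] x" for n x
    unfolding I_def
  proof (rule eval.comp)
    show "list_all2 (\<lambda>g y. eval g [x] y) (Proj 0 # replicate n Zero) (x # replicate n 0)"
      using eval.proj[of 0 "[x]"]
      by (auto simp: list_all2_conv_all_nth nth_Cons eval.zero split: nat.split)
    show "eval (Proj 0) (x # replicate n 0) x"
      using eval.proj[of 0 "x # replicate n 0"] by simp
  qed
  have "inj (\<lambda>n. encode (I n))"
    by (rule injI) (auto simp: I_def list_encode_eq dest: arg_cong[where f = length])
  then have "infinite (range (\<lambda>n. encode (I n)))" by (simp add: finite_image_iff)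
  moreover have "range (\<lambda>n. encode (I n)) \<subseteq> program_part ` acting"
  proof (intro image_subsetI)
    fix n
    have "column (encode (I n)) 0 \<notin> range ((^) 2)" using column_neq_pow2 by blast
    then have "\<exists>s. candidate s \<and> program_part s = encode (I n)"
      using candidate_iff[of "I n" "column (encode (I n)) 0"] I by blast
    then show "encode (I n) \<in> program_part ` acting" using candidate_imp_acting by force
  qed
  ultimately show False using \<open>finite acting\<close> finite_subset by blast
qed

text \<open>
  The structure \<open>A\<close> pairs \<open>4 ^ k\<close> with \<open>2 * 4 ^ k\<close>, so that \<open>A(2)\<close> is the decidable set of powers of
  two.\<close>

interpretation A: matching UNIV "\<lambda>k. 2 ^ (2 * k)" "\<lambda>k. 2 ^ (2 * k + 1)"
proof
  show "range (\<lambda>k. 2 ^ (2 * k)) \<inter> range (\<lambda>k. 2 ^ (2 * k + 1)) = ({} :: nat set)"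
  proof -
    have "(2 :: nat) ^ (2 * k) \<noteq> 2 ^ (2 * l + 1)" for k l
      using power_inject_exp[of "2 :: nat" "2 * k" "2 * l + 1"] by presburger
    then show ?thesis by blast
  qed
qed (auto simp: inj_on_def)

text \<open>
  The structure \<open>C\<close> pairs the target of an acting stage \<open>s\<close> with \<open>2 ^ s\<close>. The partner exceeds
  \<open>s\<close>, so the relation is decidable although \<open>C(2)\<close> is only enumerable.\<close>

interpretation C: matching acting "(^) 2" target
proof
  show "inj_on target acting"
    using inj_on_program_part column_eqD unfolding inj_on_def target_def by blast
  show "(^) 2 ` acting \<inter> target ` acting = {}"
    using column_neq_pow2 unfolding target_def by (metis (no_types, lifting) disjoint_iff image_iff)
qed (auto simp: inj_on_def)

lemma A_elements_of_size_1: "elements_of_size A.pairing 1 = - range ((^) 2)"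
proof -
  have "range (\<lambda>k. 2 ^ (2 * k)) \<union> range (\<lambda>k. 2 ^ (2 * k + 1)) = range ((^) (2 :: nat))"
  proof (intro equalityI subsetI)
    fix x :: nat assume "x \<in> range (\<lambda>k. 2 ^ (2 * k)) \<union> range (\<lambda>k. 2 ^ (2 * k + 1))"
    then show "x \<in> range ((^) 2)" by blast
  next
    fix x :: nat assume "x \<in> range ((^) 2)"
    then obtain k where "x = 2 ^ k" by blast
    then show "x \<in> range (\<lambda>k. 2 ^ (2 * k)) \<union> range (\<lambda>k. 2 ^ (2 * k + 1))"
      by (cases "even k") (auto elim!: evenE oddE)
  qed
  then show ?thesis unfolding A.elements_of_size_1 by simp
qed

lemma A_density: "has_density (elements_of_size A.pairing 1) 1"
  unfolding A_elements_of_size_1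
  by (rule has_density_1_sparse_complement[where h = "\<lambda>k. k"]) auto

text \<open>
  Column \<open>e\<close> contributes at most one target, and that is at least \<open>2 ^ e\<close>; the partners are
  powers of two.\<close>

lemma C_density: "has_density (elements_of_size C.pairing 1) 1"
proof -
  have "has_density (- (^) 2 ` acting) 1"
    by (rule has_density_1_sparse_complement[where h = "\<lambda>k. k"]) auto
  moreover have "has_density (- target ` acting) 1"
    by (rule has_density_1_sparse_complement[OF inj_on_program_part]) (simp add: target_def column_def)
  ultimately show ?thesis unfolding C.elements_of_size_1 Compl_Un by (rule has_density_1_Int)
qed

lemma not_generically_computably_isomorphic:
  "\<not> generically_computably_isomorphic A.pairing C.pairing"
proof
  assume "generically_computably_isomorphic A.pairing C.pairing"
  then obtain f \<theta> p where iso: "isomorphism A.pairing C.pairing f"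
    and p: "\<And>x y. \<theta> x = Some y \<longleftrightarrow> eval p [x] y"
    and ran: "has_density (ran \<theta>) 1" and \<theta>: "\<And>x. x \<in> dom \<theta> \<Longrightarrow> \<theta> x = Some (f x)"
    unfolding generically_computably_isomorphic_def partial_computable_def by blast
  \<comment> \<open>powers of two are exactly the elements of \<open>A(2)\<close>, and an isomorphism preserves sizes of classes\<close>
  have f: "y \<in> elements_of_size C.pairing 1 \<longleftrightarrow> x \<notin> range ((^) 2)" if "eval p [x] y" for x y
  proof -
    have "\<theta> x = Some y" using that p by blast
    then have "y = f x" using \<theta>[of x] by auto
    then show ?thesis
      using isomorphism_elements_of_size[OF iso, of x 1] unfolding A_elements_of_size_1 by blast
  qed
  have "has_density (ran \<theta> \<inter> elements_of_size C.pairing 1) 1"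
    using ran C_density by (rule has_density_1_Int)
  then have "\<exists>m. 2 ^ encode p * 3 + 2 ^ (encode p + 1) * m
      \<in> ran \<theta> \<inter> elements_of_size C.pairing 1"
    by (rule has_density_1_meets_progression) simp
  then obtain m where "2 ^ encode p * 3 + 2 ^ (encode p + 1) * m
      \<in> ran \<theta> \<inter> elements_of_size C.pairing 1" ..
  then have m: "column (encode p) m \<in> ran \<theta> \<inter> elements_of_size C.pairing 1"
    by (simp add: column_def algebra_simps)
  then obtain x where x: "eval p [x] (column (encode p) m)" by (auto simp: ran_def p)
  with m f have "x \<notin> range ((^) 2)" by blast
  \<comment> \<open>so \<open>p\<close> has a candidate; the acting stage may have another target, and it is this one that refutes \<open>p\<close>\<close>
  with x obtain s where s: "s \<in> acting" "program_part s = encode p"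
    using candidate_iff[of p "column (encode p) m"] candidate_imp_acting by metis
  then obtain x' where "x' \<notin> range ((^) 2)" "eval p [x'] (target s)"
    using candidate_iff[of p "target s"] by (auto simp: acting_def)
  then have "target s \<in> elements_of_size C.pairing 1" using f by blast
  with s(1) show False unfolding C.elements_of_size_1 by blast
qed

theorem theorem4p7:
  "\<exists>A C :: nat rel.
     computable_equiv_structure A \<and> one_two_structure A \<and> generic_character A 1 \<and>
     computable_equiv_structure C \<and> one_two_structure C \<and> generic_character C 1 \<and>
     \<not> generically_computably_isomorphic A C"
proof (intro exI conjI)
  show "computable_equiv_structure A.pairing"
  proof (rule A.computable_pairing)
    show "k \<le> 2 ^ (2 * k)" for k :: nat
      using less_exp[of "2 * k"] by linarith
    show "decidable1 (\<lambda>k. k \<in> UNIV)"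
      using decidable_eq[OF computable_const computable_const, of "Suc 0" 0 0] by simp
  qed (intro computable_intros)+
  show "one_two_structure A.pairing"
    using A.one_two_structure_pairing infinite_of_density_1[OF A_density]
    unfolding A.elements_of_size_1 by simp
  show "computable_equiv_structure C.pairing"
    by (rule C.computable_pairing) (auto intro: decidable1_acting computable1_target computable1_pow2)
  show "one_two_structure C.pairing"
    using C.one_two_structure_pairing infinite_acting infinite_of_density_1[OF C_density]
    unfolding C.elements_of_size_1 by blast
  show "generic_character A.pairing 1" "generic_character C.pairing 1"
    unfolding generic_character_def by (rule A_density C_density)+
qed (rule not_generically_computably_isomorphic)

end
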